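(* Let $0<\alpha<4\beta<\infty$ and $\lambda\in\left(0,2-\frac{\alpha}{2\beta}\right)$. Let $H$ be a real Hilbert space, let $A\colon H\rightrightarrows H$ and $B\colon H\rightrightarrows H$ be monotone, and let $C\colon H\rightrightarrows H$ be $\beta$-cocoercive. (1) If $A$ is $\mu_A$-strongly monotone and $L_A$-Lipschitz with $0<\mu_A\le L_A<\infty$, then $T_{A,B,C,\alpha,\lambda}$ is $\rho$-contractive with $$\rho=1-\frac{2\lambda}{4-\alpha/\beta}+\lambda\sqrt{\frac{2}{4-\alpha/\beta}\left(\frac{2}{4-\alpha/\beta}-\frac{2\alpha\mu_A}{\alpha^2L_A^2+2\alpha\mu_A+1}\right)}.$$ (2) Symmetrically, if $B$ is $\mu_B$-strongly monotone and $L_B$-Lipschitz with $0<\mu_B\le L_B<\infty$, then $T_{A,B,C,\alpha,\lambda}$ is $\rho$-contractive with $$\rho=1-\frac{2\lambda}{4-\alpha/\beta}+\lambda\sqrt{\frac{2}{4-\alpha/\beta}\left(\frac{2}{4-\alpha/\beta}-\frac{2\alpha\mu_B}{\alpha^2L_B^2+2\alpha\mu_B+1}\right)}.$$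
   Context: A (multi-valued) operator $A\colon H\rightrightarrows H$ is identified with its graph, a subset of $H\times H$; $u\in Ax$ means $(x,u)\in A$, and $\mathrm{dom}\,A=\{x:Ax\ne\emptyset\}$. Operators need not have full domain and monotone operators need not be maximal. Set $A^{-1}=\{(u,x):(x,u)\in A\}$, $A+B=\{(x,u+v):(x,u)\in A,(x,v)\in B\}$, $AB=\{(x,s):\exists u,\ (x,u)\in B,\ (u,s)\in A\}$, $I$ the identity, and $J_{\alpha A}=(I+\alpha A)^{-1}$ the resolvent. For all $u\in Ax$, $v\in Ay$: $A$ is monotone if $\langle x-y,u-v\rangle\ge0$; $\mu$-strongly monotone if $\langle x-y,u-v\rangle\ge\mu\|x-y\|^2$; $L$-Lipschitz if $\|u-v\|\le L\|x-y\|$; $\beta$-cocoercive if $\langle x-y,u-v\rangle\ge\beta\|u-v\|^2$. (Lipschitz and cocoercive operators, and resolvents of monotone operators, are single-valued on their domains.) The (averaged) Davis–Yin splitting operator with stepsize $\alpha$ and averaging parameter $\lambda$ is $$T_{A,B,C,\alpha,\lambda}=I-\lambda J_{\alpha B}+\lambda J_{\alpha A}(2J_{\alpha B}-I-\alpha CJ_{\alpha B}),$$ which under the present assumptions is single-valued on its domain. A single-valued operator $T$ is $\rho$-contractive if $\|Tx-Ty\|\le\rho\|x-y\|$ for all $x,y\in\mathrm{dom}\,T$. *)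

theory Defs
  imports "HOL-Analysis.Analysis"
begin

text \<open>
  A multi-valued operator is its graph, a relation \<open>'a rel\<close>; \<open>(x, u) \<in> A\<close> means \<open>u \<in> A x\<close>.
  The identity operator is \<^const>\<open>Id\<close>, the inverse operator is \<^const>\<open>converse\<close>, the domain
  is \<^const>\<open>Domain\<close>. No operator is assumed to have full domain or to be maximal monotone.
\<close>

definition op_add :: "'a::real_vector rel \<Rightarrow> 'a rel \<Rightarrow> 'a rel"  (infixl \<open>\<oplus>\<^sub>o\<close> 65)
  where "A \<oplus>\<^sub>o B = {(x, u + v) | x u v. (x, u) \<in> A \<and> (x, v) \<in> B}"

definition op_scale :: "real \<Rightarrow> 'a::real_vector rel \<Rightarrow> 'a rel"  (infixr \<open>\<cdot>\<^sub>o\<close> 75)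
  where "c \<cdot>\<^sub>o A = {(x, c *\<^sub>R u) | x u. (x, u) \<in> A}"

definition op_diff :: "'a::real_vector rel \<Rightarrow> 'a rel \<Rightarrow> 'a rel"  (infixl \<open>\<ominus>\<^sub>o\<close> 65)
  where "A \<ominus>\<^sub>o B = A \<oplus>\<^sub>o (- 1) \<cdot>\<^sub>o B"

text \<open>In \<open>A \<circ>\<^sub>o B\<close> the operator \<open>B\<close> acts first, whereas in \<^const>\<open>relcomp\<close> the left one does.\<close>

definition op_comp :: "'a rel \<Rightarrow> 'a rel \<Rightarrow> 'a rel"  (infixr \<open>\<circ>\<^sub>o\<close> 80)
  where "A \<circ>\<^sub>o B = B O A"

definition resolvent :: "'a::real_vector rel \<Rightarrow> 'a rel"
  where "resolvent A = (Id \<oplus>\<^sub>o A)\<inverse>"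

definition monotone_op :: "'a::real_inner rel \<Rightarrow> bool"
  where "monotone_op A \<longleftrightarrow>
    (\<forall>x u y v. (x, u) \<in> A \<longrightarrow> (y, v) \<in> A \<longrightarrow> (x - y) \<bullet> (u - v) \<ge> 0)"

definition strongly_monotone_op :: "real \<Rightarrow> 'a::real_inner rel \<Rightarrow> bool"
  where "strongly_monotone_op \<mu> A \<longleftrightarrow>
    (\<forall>x u y v. (x, u) \<in> A \<longrightarrow> (y, v) \<in> A \<longrightarrow> (x - y) \<bullet> (u - v) \<ge> \<mu> * (norm (x - y))\<^sup>2)"

definition Lipschitz_op :: "real \<Rightarrow> 'a::real_normed_vector rel \<Rightarrow> bool"
  where "Lipschitz_op L A \<longleftrightarrow>
    (\<forall>x u y v. (x, u) \<in> A \<longrightarrow> (y, v) \<in> A \<longrightarrow> norm (u - v) \<le> L * norm (x - y))"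

definition cocoercive_op :: "real \<Rightarrow> 'a::real_inner rel \<Rightarrow> bool"
  where "cocoercive_op \<beta> A \<longleftrightarrow>
    (\<forall>x u y v. (x, u) \<in> A \<longrightarrow> (y, v) \<in> A \<longrightarrow> (x - y) \<bullet> (u - v) \<ge> \<beta> * (norm (u - v))\<^sup>2)"

definition contractive_op :: "real \<Rightarrow> 'a::real_normed_vector rel \<Rightarrow> bool"
  where "contractive_op \<rho> T \<longleftrightarrow> single_valued T \<and>
    (\<forall>x u y v. (x, u) \<in> T \<longrightarrow> (y, v) \<in> T \<longrightarrow> norm (u - v) \<le> \<rho> * norm (x - y))"

definition DYS :: "'a::real_vector rel \<Rightarrow> 'a rel \<Rightarrow> 'a rel \<Rightarrow> real \<Rightarrow> real \<Rightarrow> 'a rel"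
  where "DYS A B C \<alpha> l =
    (let JA = resolvent (\<alpha> \<cdot>\<^sub>o A); JB = resolvent (\<alpha> \<cdot>\<^sub>o B)
     in Id \<ominus>\<^sub>o l \<cdot>\<^sub>o JB \<oplus>\<^sub>o l \<cdot>\<^sub>o (JA \<circ>\<^sub>o (2 \<cdot>\<^sub>o JB \<ominus>\<^sub>o Id \<ominus>\<^sub>o \<alpha> \<cdot>\<^sub>o (C \<circ>\<^sub>o JB))))"

end

theory Submission
  imports Defs
begin

text \<open>
  Let \<open>z\<close> be the difference of two inputs of the splitting operator, \<open>x\<close> and \<open>y\<close> the differences
  of the outputs of the resolvents of \<open>\<alpha>B\<close> and \<open>\<alpha>A\<close>, and \<open>b\<close>, \<open>a\<close>, \<open>c\<close> the differences of the
  elements of \<open>\<alpha>B x\<close>, \<open>\<alpha>A y\<close>, \<open>\<alpha>C x\<close>. Then \<open>z = x + b\<close>, and the displacement is \<open>l S\<close> with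
  \<open>S = x - y = a + b + c\<close>. Write \<open>\<theta> = 2 / (4 - \<alpha>/\<beta>)\<close>. As \<open>z - l S\<close> is the convex combination
  of \<open>z\<close> and \<open>z - S / \<theta>\<close> with weights \<open>1 - l \<theta>\<close> and \<open>l \<theta>\<close>, the claimed factor comes from
  \<open>k \<parallel>z\<parallel>\<^sup>2 \<le> 2 \<langle>z, S\<rangle> - \<parallel>S\<parallel>\<^sup>2 / \<theta>\<close>, where \<open>k\<close> is the fraction under the square root. The
  hypotheses on \<open>B\<close> or \<open>A\<close> enter only as \<open>k \<parallel>x + b\<parallel>\<^sup>2 \<le> 2 \<langle>x, b\<rangle>\<close> or
  \<open>k \<parallel>y + a\<parallel>\<^sup>2 \<le> 2 \<langle>y, a\<rangle>\<close>, and in both cases an explicit sum of squares with nonnegative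
  multipliers proves the inequality.
\<close>

section \<open>Contraction factor from a quadratic inequality\<close>

lemma norm_relaxed_step_le:
  fixes z S :: "'a::real_inner"
  assumes "0 < \<theta>" "0 \<le> l" "l * \<theta> \<le> 1" "k \<le> \<theta>"
    and gap: "k * (norm z)\<^sup>2 \<le> 2 * (z \<bullet> S) - (norm S)\<^sup>2 / \<theta>"
  shows "norm (z - l *\<^sub>R S) \<le> (1 - l * \<theta> + l * sqrt (\<theta> * (\<theta> - k))) * norm z"
proof -
  \<comment> \<open>This is \<theta> times the endpoint \<open>z - S / \<theta>\<close> of the
    convex combination, scaled to keep the expansion free of fractions.\<close>
  let ?N = "\<theta> *\<^sub>R z - S"
  have "(norm ?N)\<^sup>2 = \<theta>\<^sup>2 * (norm z)\<^sup>2 - \<theta> * (2 * (z \<bullet> S)) + (norm S)\<^sup>2"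
    unfolding power2_norm_eq_inner
    by (simp add: inner_diff inner_commute algebra_simps power2_eq_square)
  also have "\<dots> = \<theta>\<^sup>2 * (norm z)\<^sup>2 - \<theta> * (2 * (z \<bullet> S) - (norm S)\<^sup>2 / \<theta>)"
    using \<open>0 < \<theta>\<close> by (simp add: right_diff_distrib)
  also have "\<dots> \<le> \<theta>\<^sup>2 * (norm z)\<^sup>2 - \<theta> * (k * (norm z)\<^sup>2)"
    using gap \<open>0 < \<theta>\<close> by (simp add: mult_left_mono)
  also have "\<dots> = (sqrt (\<theta> * (\<theta> - k)) * norm z)\<^sup>2"
    using assms by (simp add: power_mult_distrib power2_eq_square algebra_simps)
  finally have N: "norm ?N \<le> sqrt (\<theta> * (\<theta> - k)) * norm z"
    by (rule power2_le_imp_le) (use assms in simp)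
  have "z - l *\<^sub>R S = (1 - l * \<theta>) *\<^sub>R z + l *\<^sub>R ?N"
    by (simp add: algebra_simps)
  also have "norm \<dots> \<le> (1 - l * \<theta>) * norm z + l * norm ?N"
    using assms by (intro norm_triangle_le) simp
  also have "\<dots> \<le> (1 - l * \<theta>) * norm z + l * (sqrt (\<theta> * (\<theta> - k)) * norm z)"
    using N \<open>0 \<le> l\<close> by (simp add: mult_left_mono)
  finally show ?thesis by (simp add: algebra_simps)
qed

text \<open>Expand the square, bound \<open>norm u\<close> by the Lipschitz condition and
  \<open>norm x\<close> by strong monotonicity. The constant is sharp for this argument: equality in
  both hypotheses gives equality in the conclusion.\<close>

lemma strongly_monotone_Lipschitz_gap:
  fixes x u :: "'a::real_inner"
  assumes "0 < \<alpha>" "0 < \<mu>"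
    and sm: "\<mu> * (norm x)\<^sup>2 \<le> x \<bullet> u" and Lip: "norm u \<le> L * norm x"
  shows "2 * \<alpha> * \<mu> / (\<alpha>\<^sup>2 * L\<^sup>2 + 2 * \<alpha> * \<mu> + 1) * (norm (x + \<alpha> *\<^sub>R u))\<^sup>2
    \<le> 2 * (x \<bullet> (\<alpha> *\<^sub>R u))"
proof -
  let ?d = "\<alpha>\<^sup>2 * L\<^sup>2 + 2 * \<alpha> * \<mu> + 1"
  have d: "0 < ?d" using assms by (simp add: add_nonneg_pos)
  have "(norm u)\<^sup>2 \<le> L\<^sup>2 * (norm x)\<^sup>2"
    using power_mono[OF Lip norm_ge_zero, of 2] by (simp add: power_mult_distrib)
  then have "\<alpha>\<^sup>2 * (norm u)\<^sup>2 \<le> \<alpha>\<^sup>2 * (L\<^sup>2 * (norm x)\<^sup>2)"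
    by (simp add: mult_left_mono)
  then have "(norm (x + \<alpha> *\<^sub>R u))\<^sup>2 \<le> (norm x)\<^sup>2 + 2 * \<alpha> * (x \<bullet> u) + \<alpha>\<^sup>2 * (L\<^sup>2 * (norm x)\<^sup>2)"
    unfolding power2_norm_eq_inner
    by (simp add: inner_add inner_commute algebra_simps power2_eq_square)
  \<comment> \<open>The factor \<mu> lets strong monotonicity turn every
    \<open>(norm x)\<^sup>2\<close> into \<open>x \<bullet> u\<close>.\<close>
  then have "\<mu> * (norm (x + \<alpha> *\<^sub>R u))\<^sup>2
      \<le> \<mu> * ((norm x)\<^sup>2 + 2 * \<alpha> * (x \<bullet> u) + \<alpha>\<^sup>2 * (L\<^sup>2 * (norm x)\<^sup>2))"
    using \<open>0 < \<mu>\<close> by simp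
  also have "\<dots> = (\<alpha>\<^sup>2 * L\<^sup>2 + 1) * (\<mu> * (norm x)\<^sup>2) + 2 * \<alpha> * \<mu> * (x \<bullet> u)"
    by (simp add: algebra_simps)
  also have "\<dots> \<le> (\<alpha>\<^sup>2 * L\<^sup>2 + 1) * (x \<bullet> u) + 2 * \<alpha> * \<mu> * (x \<bullet> u)"
    using sm by (intro add_right_mono mult_left_mono) auto
  finally have "\<mu> * (norm (x + \<alpha> *\<^sub>R u))\<^sup>2 \<le> ?d * (x \<bullet> u)"
    by (simp add: algebra_simps)
  then have "2 * \<alpha> * (\<mu> * (norm (x + \<alpha> *\<^sub>R u))\<^sup>2) \<le> 2 * \<alpha> * (?d * (x \<bullet> u))"
    using \<open>0 < \<alpha>\<close> by simp
  then show ?thesis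
    using d by (simp add: pos_divide_le_eq algebra_simps)
qed

text \<open>The upper bound is \<open>2 * t \<le> t\<^sup>2 + 1\<close> at
  \<open>t = \<alpha> * \<mu>\<close>, combined with \<mu> \<le> \<open>L\<close>. It keeps the
  radicand nonnegative, since \<theta> is at least 1/2, and the multiplier \<open>1 - 2 * k\<close>
  as well.\<close>

lemma gap_constant_bounds:
  fixes \<alpha> \<mu> L :: real
  assumes "0 < \<alpha>" "0 < \<mu>" "\<mu> \<le> L"
  defines "k \<equiv> 2 * \<alpha> * \<mu> / (\<alpha>\<^sup>2 * L\<^sup>2 + 2 * \<alpha> * \<mu> + 1)"
  shows "0 < k" "k \<le> 1 / 2"
proof -
  have d: "0 < \<alpha>\<^sup>2 * L\<^sup>2 + 2 * \<alpha> * \<mu> + 1" using assms by (simp add: add_nonneg_pos)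
  then show "0 < k" using assms by (simp add: k_def)
  have "2 * (\<alpha> * \<mu>) \<le> (\<alpha> * \<mu>)\<^sup>2 + 1"
    using zero_le_power2[of "\<alpha> * \<mu> - 1"] by (simp add: power2_diff)
  also have "(\<alpha> * \<mu>)\<^sup>2 \<le> \<alpha>\<^sup>2 * L\<^sup>2"
    using power_mono[of \<mu> L 2] assms by (simp add: power_mult_distrib)
  finally show "k \<le> 1 / 2"
    using d by (simp add: k_def pos_divide_le_eq)
qed

section \<open>Sum-of-squares certificates\<close>

lemma splitting_gap_second:
  fixes x y a b c :: "'a::real_inner" and n :: real
  assumes "0 < n" and S: "x - y = a + b + c"
    and a: "0 \<le> y \<bullet> a" and c: "n / 2 * (norm c)\<^sup>2 \<le> x \<bullet> c"
    and b: "k * (norm (x + b))\<^sup>2 \<le> 2 * (x \<bullet> b)"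
  shows "k * (norm (x + b))\<^sup>2 \<le> 2 * ((x + b) \<bullet> (x - y)) - (2 - 1 / n) * (norm (x - y))\<^sup>2"
proof -
  define S where "S = x - y"
  have eqs: "y = x - S" "a = S - b - c"
    using S by (simp_all add: S_def algebra_simps)
  \<comment> \<open>The hypothesis \<open>b\<close> bounds the left side of the goal by
    \<open>2 * (x \<bullet> b)\<close>, so this becomes the target. The factor \<open>n\<close>
    clears \<open>1 / n\<close>, and the remaining terms in \<open>c\<close> and \<open>S\<close>
    form one square.\<close>
  have "n * (2 * ((x + b) \<bullet> S) - (2 - 1 / n) * (norm S)\<^sup>2)
      = n * (2 * (y \<bullet> a) + 2 * (x \<bullet> b) + 2 * (x \<bullet> c - n / 2 * (norm c)\<^sup>2))
        + (norm (n *\<^sub>R c - S))\<^sup>2"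
    using \<open>0 < n\<close> unfolding eqs power2_norm_eq_inner
    by (simp add: inner_add inner_diff inner_commute algebra_simps power2_eq_square)
  also have "\<dots> \<ge> n * (2 * (x \<bullet> b))"
    using a c \<open>0 < n\<close> by (intro add_increasing2) (auto simp: mult_left_mono)
  finally show ?thesis using b \<open>0 < n\<close> by (simp add: S_def)
qed

lemma splitting_gap_first_strict:
  fixes x y a b c :: "'a::real_inner" and n :: real
  assumes "0 < n" "0 < k" "k < 1 / 2" and S: "x - y = a + b + c"
    and a: "k * (norm (y + a))\<^sup>2 \<le> 2 * (y \<bullet> a)" and c: "n / 2 * (norm c)\<^sup>2 \<le> x \<bullet> c"
    and b: "0 \<le> x \<bullet> b"
  shows "k * (norm (x + b))\<^sup>2 \<le> 2 * ((x + b) \<bullet> (x - y)) - (2 - 1 / n) * (norm (x - y))\<^sup>2"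
proof -
  define S where "S = x - y"
  \<comment> \<open>Here \<open>y + a = x - b - c\<close>. Its squared norm is that of
    \<open>x + b\<close> up to \<open>- 4 * (x \<bullet> b)\<close> and terms in \<open>c\<close>.
    The weight \<open>m\<close> is the one for which the products \<open>x \<bullet> b\<close>
    cancel, so that \<open>x\<close> and \<open>b\<close> remain only through
    \<open>x + b\<close>.\<close>
  define m where "m = 1 - 2 * k"
  have eqs: "y = x - S" "a = S - b - c"
    using S by (simp_all add: S_def algebra_simps)
  have m: "0 < m" "0 < n * m" using assms by (simp_all add: m_def)
  have "n * m * (2 * ((x + b) \<bullet> S) - (2 - 1 / n) * (norm S)\<^sup>2 - k * (norm (x + b))\<^sup>2)
      = m * (n * (2 * ((x + b) \<bullet> S) - 2 * (norm S)\<^sup>2 - k * (norm (x + b))\<^sup>2) + (norm S)\<^sup>2)"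
    using \<open>0 < n\<close> by (simp add: algebra_simps)
  \<comment> \<open>The common factor \<open>k + n * m\<close> makes the remaining quadratic form in
    \<open>x + b\<close>, \<open>c\<close> and \<open>S\<close> a single square.\<close>
  also have "\<dots> = (k + n * m) * (2 * (y \<bullet> a) - k * (norm (y + a))\<^sup>2)
        + 2 * m * (k + n * m) * (x \<bullet> b + (x \<bullet> c - n / 2 * (norm c)\<^sup>2))
        + (norm (k *\<^sub>R (x + b) + (k + n * m) *\<^sub>R c - S))\<^sup>2"
    unfolding eqs power2_norm_eq_inner m_def
    by (simp add: inner_add inner_diff inner_commute algebra_simps power2_eq_square)
  also have "\<dots> \<ge> 0"
    using a b c m \<open>0 < k\<close> \<open>0 < n\<close> by (intro add_nonneg_nonneg mult_nonneg_nonneg) auto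
  finally show ?thesis using m by (simp add: zero_le_mult_iff S_def)
qed

text \<open>
  At \<open>k = 1/2\<close> the multipliers of the previous lemma degenerate, so this case is a limit.
\<close>

lemma splitting_gap_first:
  fixes x y a b c :: "'a::real_inner" and n :: real
  assumes "0 < n" "0 < k" "k \<le> 1 / 2" and S: "x - y = a + b + c"
    and a: "k * (norm (y + a))\<^sup>2 \<le> 2 * (y \<bullet> a)" and c: "n / 2 * (norm c)\<^sup>2 \<le> x \<bullet> c"
    and b: "0 \<le> x \<bullet> b"
  shows "k * (norm (x + b))\<^sup>2 \<le> 2 * ((x + b) \<bullet> (x - y)) - (2 - 1 / n) * (norm (x - y))\<^sup>2"
proof (rule field_le_mult_one_interval)
  fix t :: real assume t: "0 < t" "t < 1"
  \<comment> \<open>Replacing \<open>k\<close> by \<open>t * k\<close> weakens the hypothesis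
    \<open>a\<close> and multiplies only the left side of the goal by \<open>t\<close>, which then
    tends to 1.\<close>
  have less: "t * k < k" using t \<open>0 < k\<close> by simp
  have "t * k * (norm (y + a))\<^sup>2 \<le> k * (norm (y + a))\<^sup>2"
    using less by (intro mult_right_mono) auto
  with a have "t * k * (norm (y + a))\<^sup>2 \<le> 2 * (y \<bullet> a)" by simp
  from splitting_gap_first_strict[OF \<open>0 < n\<close> _ _ S this c b] t less assms
  show "t * (k * (norm (x + b))\<^sup>2)
      \<le> 2 * ((x + b) \<bullet> (x - y)) - (2 - 1 / n) * (norm (x - y))\<^sup>2"
    by (simp add: mult.assoc)
qed

section \<open>Resolvents and the splitting operator\<close>

lemma mem_resolvent_iff: "(z, x) \<in> resolvent (\<alpha> \<cdot>\<^sub>o A) \<longleftrightarrow> (\<exists>u. (x, u) \<in> A \<and> z = x + \<alpha> *\<^sub>R u)"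
  by (auto simp: resolvent_def op_add_def op_scale_def)

lemma resolvent_unique:
  fixes B :: "'a::real_inner rel"
  assumes "monotone_op B" "0 < \<alpha>"
    and "(z, x) \<in> resolvent (\<alpha> \<cdot>\<^sub>o B)" "(z, x') \<in> resolvent (\<alpha> \<cdot>\<^sub>o B)"
  shows "x = x'"
proof -
  obtain u u' where u: "(x, u) \<in> B" "(x', u') \<in> B" and z: "x + \<alpha> *\<^sub>R u = x' + \<alpha> *\<^sub>R u'"
    using assms(3,4) by (metis mem_resolvent_iff)
  have "0 \<le> (x - x') \<bullet> (\<alpha> *\<^sub>R (u - u'))"
    using u assms(1,2) by (simp add: monotone_op_def)
  also have "\<alpha> *\<^sub>R (u - u') = - (x - x')"
    using z by (simp add: algebra_simps)
  finally have "(norm (x - x'))\<^sup>2 \<le> 0" by (simp only: inner_minus_right power2_norm_eq_inner neg_0_le_iff_le)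
  then show ?thesis by simp
qed

lemma DYS_cases:
  fixes A B C :: "'a::real_inner rel"
  assumes "monotone_op B" "0 < \<alpha>" and mem: "(z, w) \<in> DYS A B C \<alpha> l"
  obtains x y a b c where "(y, a) \<in> A" "(x, b) \<in> B" "(x, c) \<in> C"
    "z = x + \<alpha> *\<^sub>R b" "x - y = \<alpha> *\<^sub>R a + \<alpha> *\<^sub>R b + \<alpha> *\<^sub>R c" "w = z - l *\<^sub>R (x - y)"
proof -
  let ?JA = "resolvent (\<alpha> \<cdot>\<^sub>o A)" and ?JB = "resolvent (\<alpha> \<cdot>\<^sub>o B)"
  \<comment> \<open>Sums of graphs let each of the three occurrences of the resolvent choose its own
    value; monotonicity of \<open>B\<close> identifies them.\<close>
  obtain x x' x'' y c where J: "(z, x) \<in> ?JB" "(z, x') \<in> ?JB" "(z, x'') \<in> ?JB"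
    and c: "(x'', c) \<in> C"
    and y: "(2 *\<^sub>R x' - z - \<alpha> *\<^sub>R c, y) \<in> ?JA"
    and w: "w = z - l *\<^sub>R x + l *\<^sub>R y"
    using mem
    by (auto simp: DYS_def op_diff_def op_add_def op_scale_def op_comp_def Let_def)
  have "x' = x" "x'' = x"
    using resolvent_unique[OF assms(1,2)] J by blast+
  moreover obtain b where b: "(x, b) \<in> B" "z = x + \<alpha> *\<^sub>R b"
    using J(1) by (auto simp: mem_resolvent_iff)
  moreover obtain a where "(y, a) \<in> A" "2 *\<^sub>R x' - z - \<alpha> *\<^sub>R c = y + \<alpha> *\<^sub>R a"
    using y by (auto simp: mem_resolvent_iff)
  ultimately show ?thesis
    using c w by (intro that[of y a x b c]) (simp_all add: algebra_simps scaleR_2)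
qed

text \<open>Single-valuedness is the inequality at equal inputs, where its right side is 0.\<close>

lemma contractive_opI:
  assumes "\<And>x u y v. (x, u) \<in> T \<Longrightarrow> (y, v) \<in> T \<Longrightarrow> norm (u - v) \<le> \<rho> * norm (x - y)"
  shows "contractive_op \<rho> T"
  unfolding contractive_op_def single_valued_def using assms by fastforce

text \<open>
  In the gap hypothesis, \<open>n = 2 \<beta> / \<alpha>\<close> is chosen so that \<open>2 - 1 / n = 1 / \<theta>\<close>.
\<close>

lemma DYS_contractive:
  fixes A B C :: "'a::real_inner rel"
  assumes "0 < \<alpha>" "\<alpha> < 4 * \<beta>" "0 < l" "l < 2 - \<alpha> / (2 * \<beta>)"
    and B: "monotone_op B" and C: "cocoercive_op \<beta> C" and "k \<le> 1 / 2"
    and gap: "\<And>x y a b c x' y' a' b' c'.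
      \<lbrakk>(y, a) \<in> A; (y', a') \<in> A; (x, b) \<in> B; (x', b') \<in> B;
       x - x' - (y - y') = \<alpha> *\<^sub>R (a - a') + \<alpha> *\<^sub>R (b - b') + \<alpha> *\<^sub>R c;
       2 * \<beta> / \<alpha> / 2 * (norm (\<alpha> *\<^sub>R c))\<^sup>2 \<le> (x - x') \<bullet> (\<alpha> *\<^sub>R c)\<rbrakk> \<Longrightarrow>
      k * (norm (x - x' + \<alpha> *\<^sub>R (b - b')))\<^sup>2
        \<le> 2 * ((x - x' + \<alpha> *\<^sub>R (b - b')) \<bullet> (x - x' - (y - y')))
          - (2 - 1 / (2 * \<beta> / \<alpha>)) * (norm (x - x' - (y - y')))\<^sup>2"
  shows "contractive_op
    (1 - 2 * l / (4 - \<alpha> / \<beta>)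
      + l * sqrt (2 / (4 - \<alpha> / \<beta>) * (2 / (4 - \<alpha> / \<beta>) - k)))
    (DYS A B C \<alpha> l)"
proof (rule contractive_opI)
  fix z w z' w' assume mem: "(z, w) \<in> DYS A B C \<alpha> l" "(z', w') \<in> DYS A B C \<alpha> l"
  obtain x y a b c where 1: "(y, a) \<in> A" "(x, b) \<in> B" "(x, c) \<in> C"
    "z = x + \<alpha> *\<^sub>R b" "x - y = \<alpha> *\<^sub>R a + \<alpha> *\<^sub>R b + \<alpha> *\<^sub>R c" "w = z - l *\<^sub>R (x - y)"
    using DYS_cases[OF B \<open>0 < \<alpha>\<close> mem(1)] .
  obtain x' y' a' b' c' where 2: "(y', a') \<in> A" "(x', b') \<in> B" "(x', c') \<in> C"
    "z' = x' + \<alpha> *\<^sub>R b'" "x' - y' = \<alpha> *\<^sub>R a' + \<alpha> *\<^sub>R b' + \<alpha> *\<^sub>R c'" "w' = z' - l *\<^sub>R (x' - y')"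
    using DYS_cases[OF B \<open>0 < \<alpha>\<close> mem(2)] .
  define \<theta> where "\<theta> = 2 / (4 - \<alpha> / \<beta>)"
  define S where "S = x - x' - (y - y')"
  have \<beta>: "0 < \<beta>" using assms by simp
  have pos: "0 < 4 - \<alpha> / \<beta>" and less: "4 - \<alpha> / \<beta> < 4"
    using assms \<beta> by (simp_all add: field_simps)
  have \<theta>: "0 < \<theta>" "1 / 2 \<le> \<theta>" using pos less assms(1) \<beta> by (simp_all add: \<theta>_def field_simps)
  have inv: "2 - 1 / (2 * \<beta> / \<alpha>) = 1 / \<theta>" "2 - \<alpha> / (2 * \<beta>) = 1 / \<theta>"
    by (simp_all add: \<theta>_def field_simps)
  \<comment> \<open>The upper bound on \<open>l\<close> is exactly \<open>l < 1 / \<theta>\<close>,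
    so the weights of the convex combination are nonnegative.\<close>
  have "l * \<theta> \<le> 1" using assms(4) \<theta>(1) unfolding inv by (simp add: field_simps)
  have zz: "z - z' = x - x' + \<alpha> *\<^sub>R (b - b')"
    using 1 2 by (simp add: algebra_simps)
  have SS: "S = \<alpha> *\<^sub>R (a - a') + \<alpha> *\<^sub>R (b - b') + \<alpha> *\<^sub>R (c - c')"
  proof -
    have "S = (x - y) - (x' - y')" by (simp add: S_def)
    then show ?thesis unfolding 1(5) 2(5) by (simp add: algebra_simps)
  qed
  have "\<beta> * (norm (c - c'))\<^sup>2 \<le> (x - x') \<bullet> (c - c')"
    using C 1(3) 2(3) by (simp add: cocoercive_op_def)
  then have "\<alpha> * (\<beta> * (norm (c - c'))\<^sup>2) \<le> \<alpha> * ((x - x') \<bullet> (c - c'))"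
    using assms(1) by simp
  \<comment> \<open>Scaling by \<alpha> turns \<beta>-cocoercivity into cocoercivity with constant
    \<beta>/\<alpha>, which is \<open>n / 2\<close>.\<close>
  then have "2 * \<beta> / \<alpha> / 2 * (norm (\<alpha> *\<^sub>R (c - c')))\<^sup>2 \<le> (x - x') \<bullet> (\<alpha> *\<^sub>R (c - c'))"
    using assms(1) by (simp add: power_mult_distrib power2_eq_square mult_ac)
  from gap[OF 1(1) 2(1) 1(2) 2(2) SS[unfolded S_def] this]
  have "k * (norm (z - z'))\<^sup>2 \<le> 2 * ((z - z') \<bullet> S) - (norm S)\<^sup>2 / \<theta>"
    unfolding zz[symmetric] S_def[symmetric] inv by simp
  moreover have "w - w' = z - z' - l *\<^sub>R S"
    unfolding 1(6) 2(6) S_def by (simp add: algebra_simps)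
  ultimately have "norm (w - w') \<le> (1 - l * \<theta> + l * sqrt (\<theta> * (\<theta> - k))) * norm (z - z')"
    using norm_relaxed_step_le[of \<theta> l k "z - z'" S] \<theta> \<open>l * \<theta> \<le> 1\<close> assms by simp
  then show "norm (w - w') \<le> (1 - 2 * l / (4 - \<alpha> / \<beta>)
      + l * sqrt (2 / (4 - \<alpha> / \<beta>) * (2 / (4 - \<alpha> / \<beta>) - k))) * norm (z - z')"
    by (simp add: \<theta>_def mult.commute)
qed

theorem theorem3p1:
  fixes A B C :: "'a::{real_inner, complete_space} rel"
    and \<alpha> \<beta> l :: real
  assumes "0 < \<alpha>" and "\<alpha> < 4 * \<beta>"
    and "0 < l" and "l < 2 - \<alpha> / (2 * \<beta>)"
    and "monotone_op A" and "monotone_op B" and "cocoercive_op \<beta> C"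
  shows
    "(\<forall>\<mu>\<^sub>A L\<^sub>A. 0 < \<mu>\<^sub>A \<and> \<mu>\<^sub>A \<le> L\<^sub>A \<and> strongly_monotone_op \<mu>\<^sub>A A \<and> Lipschitz_op L\<^sub>A A \<longrightarrow>
        contractive_op
          (1 - 2 * l / (4 - \<alpha> / \<beta>)
            + l * sqrt (2 / (4 - \<alpha> / \<beta>) *
                (2 / (4 - \<alpha> / \<beta>) - 2 * \<alpha> * \<mu>\<^sub>A / (\<alpha>\<^sup>2 * L\<^sub>A\<^sup>2 + 2 * \<alpha> * \<mu>\<^sub>A + 1))))
          (DYS A B C \<alpha> l))
     \<and>
     (\<forall>\<mu>\<^sub>B L\<^sub>B. 0 < \<mu>\<^sub>B \<and> \<mu>\<^sub>B \<le> L\<^sub>B \<and> strongly_monotone_op \<mu>\<^sub>B B \<and> Lipschitz_op L\<^sub>B B \<longrightarrow>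
        contractive_op
          (1 - 2 * l / (4 - \<alpha> / \<beta>)
            + l * sqrt (2 / (4 - \<alpha> / \<beta>) *
                (2 / (4 - \<alpha> / \<beta>) - 2 * \<alpha> * \<mu>\<^sub>B / (\<alpha>\<^sup>2 * L\<^sub>B\<^sup>2 + 2 * \<alpha> * \<mu>\<^sub>B + 1))))
          (DYS A B C \<alpha> l))"
proof (intro conjI allI impI; elim conjE)
  have n: "0 < 2 * \<beta> / \<alpha>" using assms by simp
  {
    fix \<mu> L :: real
    assume \<mu>: "0 < \<mu>" "\<mu> \<le> L" and A: "strongly_monotone_op \<mu> A" "Lipschitz_op L A"
    note k = gap_constant_bounds[OF assms(1) \<mu>]
    show "contractive_op
          (1 - 2 * l / (4 - \<alpha> / \<beta>)
            + l * sqrt (2 / (4 - \<alpha> / \<beta>) *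
                (2 / (4 - \<alpha> / \<beta>) - 2 * \<alpha> * \<mu> / (\<alpha>\<^sup>2 * L\<^sup>2 + 2 * \<alpha> * \<mu> + 1))))
          (DYS A B C \<alpha> l)"
    proof (rule DYS_contractive[OF assms(1-4,6,7) k(2)], rule splitting_gap_first[OF n k])
      fix y a y' a' assume "(y, a) \<in> A" "(y', a') \<in> A"
      then show "2 * \<alpha> * \<mu> / (\<alpha>\<^sup>2 * L\<^sup>2 + 2 * \<alpha> * \<mu> + 1) * (norm (y - y' + \<alpha> *\<^sub>R (a - a')))\<^sup>2
          \<le> 2 * ((y - y') \<bullet> (\<alpha> *\<^sub>R (a - a')))"
        using A assms(1) \<mu>(1)
        by (intro strongly_monotone_Lipschitz_gap)
          (auto simp: strongly_monotone_op_def Lipschitz_op_def)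
    next
      fix x b x' b' assume "(x, b) \<in> B" "(x', b') \<in> B"
      then show "0 \<le> (x - x') \<bullet> (\<alpha> *\<^sub>R (b - b'))"
        using assms(1,6) by (simp add: monotone_op_def)
    qed
  }
  {
    fix \<mu> L :: real
    assume \<mu>: "0 < \<mu>" "\<mu> \<le> L" and B: "strongly_monotone_op \<mu> B" "Lipschitz_op L B"
    note k = gap_constant_bounds[OF assms(1) \<mu>]
    show "contractive_op
          (1 - 2 * l / (4 - \<alpha> / \<beta>)
            + l * sqrt (2 / (4 - \<alpha> / \<beta>) *
                (2 / (4 - \<alpha> / \<beta>) - 2 * \<alpha> * \<mu> / (\<alpha>\<^sup>2 * L\<^sup>2 + 2 * \<alpha> * \<mu> + 1))))
          (DYS A B C \<alpha> l)"
    \<comment> \<open>The splitting treats \<open>A\<close> and \<open>B\<close> differently, as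
      \<open>C\<close> is evaluated at the resolvent of \<open>B\<close>; hence a separate
      certificate instead of an exchange of roles.\<close>
    proof (rule DYS_contractive[OF assms(1-4,6,7) k(2)], rule splitting_gap_second[OF n])
      fix y a y' a' assume "(y, a) \<in> A" "(y', a') \<in> A"
      then show "0 \<le> (y - y') \<bullet> (\<alpha> *\<^sub>R (a - a'))"
        using assms(1,5) by (simp add: monotone_op_def)
    next
      fix x b x' b' assume "(x, b) \<in> B" "(x', b') \<in> B"
      then show "2 * \<alpha> * \<mu> / (\<alpha>\<^sup>2 * L\<^sup>2 + 2 * \<alpha> * \<mu> + 1) * (norm (x - x' + \<alpha> *\<^sub>R (b - b')))\<^sup>2
          \<le> 2 * ((x - x') \<bullet> (\<alpha> *\<^sub>R (b - b')))"
        using B assms(1) \<mu>(1)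
        by (intro strongly_monotone_Lipschitz_gap)
          (auto simp: strongly_monotone_op_def Lipschitz_op_def)
    qed
  }
qed

end
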